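(* Let $(\mathfrak{h}_1,\alpha)$ be a multiplicative Heisenberg Hom-Lie superalgebra over $\mathbb{C}$. Every infinitesimal deformation of $(\mathfrak{h}_{1},\alpha)$ which is not a Lie superalgebra is isomorphic, as a Hom-Lie superalgebra, to $L_{1,2}^{46,a,0}$ for some $a\neq0$ (and some values of its structure constants $\beta,\mu\in\mathbb{C}$).
   Context: A Hom-Lie superalgebra $\mathfrak{g}=(V,[\cdot,\cdot],\alpha)$ over $\mathbb{C}$ consists of a $\mathbb{Z}_2$-graded vector space $V=V_{\bar 0}\oplus V_{\bar 1}$, an even bilinear map $[\cdot,\cdot]$ and an even linear map $\alpha:V\to V$ such that for homogeneous $x,y,z$: $[x,y]=-(-1)^{|x||y|}[y,x]$ and $\circlearrowleft_{x,y,z}(-1)^{|x||z|}[\alpha(x),[y,z]]=0$ (cyclic sum). It is multiplicative if $\alpha([x,y])=[\alpha(x),\alpha(y)]$. Two Hom-Lie superalgebras are isomorphic if there is an even bijective linear map $\phi$ between them preserving brackets and with $\phi\circ\alpha=\beta\circ\phi$ for the twisting maps $\alpha,\beta$. $\mathfrak{h}_1$: basis $\{h\mid v_1,v_2\}$ ($h$ even, $v_1,v_2$ odd), $[v_1,v_2]=[v_2,v_1]=h$, other brackets of basis elements zero. $(\mathfrak{h}_1,\alpha)$ denotes $\mathfrak{h}_1$ with twisting map $\alpha$. $L_{1,2}^{46,a,b}$ ($a^2+b^2\neq0$) denotes the Hom-Lie superalgebra with basis $\{e_1\mid e_2,e_3\}$ ($e_1$ even, $e_2,e_3$ odd), bracket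 $[e_1,e_2]=0$, $[e_1,e_3]=\beta e_2$, $[e_2,e_2]=0$, $[e_2,e_3]=\mu e_1$, $[e_3,e_3]=0$ (with $\beta,\mu\in\mathbb{C}$), and twisting map $\sigma=\begin{pmatrix}0&0&0\\0&0&a\\0&0&b\end{pmatrix}$ in the basis $(e_1,e_2,e_3)$, columns being images of basis vectors. Infinitesimal deformations: let $\mathfrak{g}=(V,[\cdot,\cdot]_0,\alpha)$ be a Hom-Lie superalgebra and $\varphi:V\times V\to V$ an even bilinear map commuting with $\alpha$ ($\alpha(\varphi(x,y))=\varphi(\alpha(x),\alpha(y))$). The map $[\cdot,\cdot]_t=[\cdot,\cdot]_0+t\varphi(\cdot,\cdot)$, or the Hom-Lie superalgebra $\mathfrak{g}_t=(V,[\cdot,\cdot]_t,\alpha)$, is an infinitesimal deformation of $\mathfrak{g}$ if $[x,y]_t=-(-1)^{|x||y|}[y,x]_t$ and $\circlearrowleft_{x,y,z}(-1)^{|x||z|}[\alpha(x),[y,z]_t]_t=0$ identically in the parameter $t$. For isomorphism types, $t$ is a nonzero complex parameter. The deformation is a Lie superalgebra if $(V,[\cdot,\cdot]_t)$ satisfies the ordinary super Jacobi identity $\circlearrowleft_{x,y,z}(-1)^{|x||z|}[x,[y,z]_t]_t=0$.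
   Formalization: The formal theorem additionally assumes that the twisting map α is nonzero and that the deformed bracket [v_1,v_2]_t is nonzero at the given t; without either condition there are non-Lie deformations not isomorphic to any L_{1,2}^{46,a,0} with a≠0. *)

theory Defs
  imports "HOL-Analysis.Analysis" "HOL-Library.Z2"
begin

text \<open>
  A bracket and a twisting map on a complex vector space graded by \<open>bit\<close> (the field with two
  elements). The underlying space is the whole type \<open>'v\<close>; \<open>scal\<close> is the scalar multiplication
  and \<open>gr p\<close> is the set of homogeneous elements of parity \<open>p\<close> (with \<open>0\<close> in both).
\<close>

record 'v hom_superalgebra =
  scal :: "complex \<Rightarrow> 'v \<Rightarrow> 'v"
  gr :: "bit \<Rightarrow> 'v set"
  brk :: "'v \<Rightarrow> 'v \<Rightarrow> 'v"
  twist :: "'v \<Rightarrow> 'v"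

definition super_space :: "('v::ab_group_add, 'm) hom_superalgebra_scheme \<Rightarrow> bool" where
  "super_space G \<longleftrightarrow> vector_space (scal G) \<and> (\<forall>p. module.subspace (scal G) (gr G p)) \<and>
     gr G 0 \<inter> gr G 1 = {0} \<and> (\<forall>x. \<exists>a\<in>gr G 0. \<exists>b\<in>gr G 1. x = a + b)"

definition even_linear ::
  "('v::ab_group_add, 'm) hom_superalgebra_scheme \<Rightarrow> ('w::ab_group_add, 'n) hom_superalgebra_scheme
    \<Rightarrow> ('v \<Rightarrow> 'w) \<Rightarrow> bool" where
  "even_linear G H f \<longleftrightarrow> Vector_Spaces.linear (scal G) (scal H) f \<and> (\<forall>p. f ` gr G p \<subseteq> gr H p)"

definition even_bilinear ::
  "('v::ab_group_add, 'm) hom_superalgebra_scheme \<Rightarrow> ('v \<Rightarrow> 'v \<Rightarrow> 'v) \<Rightarrow> bool" where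
  "even_bilinear G f \<longleftrightarrow>
     (\<forall>x. Vector_Spaces.linear (scal G) (scal G) (\<lambda>y. f x y)) \<and>
     (\<forall>y. Vector_Spaces.linear (scal G) (scal G) (\<lambda>x. f x y)) \<and>
     (\<forall>p q. \<forall>x\<in>gr G p. \<forall>y\<in>gr G q. f x y \<in> gr G (p + q))"

text \<open>\<open>ksign p q\<close> is \<open>(-1)^(p q)\<close>.\<close>

definition ksign :: "bit \<Rightarrow> bit \<Rightarrow> complex" where
  "ksign p q = (if p = 1 \<and> q = 1 then -1 else 1)"

definition super_skew :: "('v::ab_group_add, 'm) hom_superalgebra_scheme \<Rightarrow> bool" where
  "super_skew G \<longleftrightarrow>
     (\<forall>p q. \<forall>x\<in>gr G p. \<forall>y\<in>gr G q. brk G x y = - scal G (ksign p q) (brk G y x))"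

definition hom_jacobi :: "('v::ab_group_add, 'm) hom_superalgebra_scheme \<Rightarrow> bool" where
  "hom_jacobi G \<longleftrightarrow>
     (\<forall>p q r. \<forall>x\<in>gr G p. \<forall>y\<in>gr G q. \<forall>z\<in>gr G r.
        scal G (ksign p r) (brk G (twist G x) (brk G y z)) +
        scal G (ksign q p) (brk G (twist G y) (brk G z x)) +
        scal G (ksign r q) (brk G (twist G z) (brk G x y)) = 0)"

definition super_jacobi :: "('v::ab_group_add, 'm) hom_superalgebra_scheme \<Rightarrow> bool" where
  "super_jacobi G \<longleftrightarrow>
     (\<forall>p q r. \<forall>x\<in>gr G p. \<forall>y\<in>gr G q. \<forall>z\<in>gr G r.
        scal G (ksign p r) (brk G x (brk G y z)) +
        scal G (ksign q p) (brk G y (brk G z x)) +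
        scal G (ksign r q) (brk G z (brk G x y)) = 0)"

definition hom_lie_superalgebra :: "('v::ab_group_add, 'm) hom_superalgebra_scheme \<Rightarrow> bool" where
  "hom_lie_superalgebra G \<longleftrightarrow> super_space G \<and> even_bilinear G (brk G) \<and>
     even_linear G G (twist G) \<and> super_skew G \<and> hom_jacobi G"

text \<open>The twisting map plays no role here.\<close>

definition lie_superalgebra :: "('v::ab_group_add, 'm) hom_superalgebra_scheme \<Rightarrow> bool" where
  "lie_superalgebra G \<longleftrightarrow> super_space G \<and> even_bilinear G (brk G) \<and> super_skew G \<and> super_jacobi G"

definition multiplicative :: "('v::ab_group_add, 'm) hom_superalgebra_scheme \<Rightarrow> bool" where
  "multiplicative G \<longleftrightarrow> (\<forall>x y. twist G (brk G x y) = brk G (twist G x) (twist G y))"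

definition hom_lie_isomorphic ::
  "('v::ab_group_add, 'm) hom_superalgebra_scheme \<Rightarrow> ('w::ab_group_add, 'n) hom_superalgebra_scheme
    \<Rightarrow> bool" where
  "hom_lie_isomorphic G H \<longleftrightarrow> hom_lie_superalgebra G \<and> hom_lie_superalgebra H \<and>
     (\<exists>f. even_linear G H f \<and> bij f \<and> (\<forall>x y. f (brk G x y) = brk H (f x) (f y)) \<and>
          f \<circ> twist G = twist H \<circ> f)"

definition deform ::
  "('v::ab_group_add, 'm) hom_superalgebra_scheme \<Rightarrow> ('v \<Rightarrow> 'v \<Rightarrow> 'v) \<Rightarrow> complex
    \<Rightarrow> ('v, 'm) hom_superalgebra_scheme" where
  "deform G \<phi> t = G\<lparr>brk := \<lambda>x y. brk G x y + scal G t (\<phi> x y)\<rparr>"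

text \<open>
  The identities hold identically in the parameter; they are polynomial in \<open>t\<close>, so this is
  expressed by quantifying over all complex \<open>t\<close>.
\<close>

definition infinitesimal_deformation ::
  "('v::ab_group_add, 'm) hom_superalgebra_scheme \<Rightarrow> ('v \<Rightarrow> 'v \<Rightarrow> 'v) \<Rightarrow> bool" where
  "infinitesimal_deformation G \<phi> \<longleftrightarrow> hom_lie_superalgebra G \<and> even_bilinear G \<phi> \<and>
     (\<forall>x y. twist G (\<phi> x y) = \<phi> (twist G x) (twist G y)) \<and>
     (\<forall>t. super_skew (deform G \<phi> t) \<and> hom_jacobi (deform G \<phi> t))"

text \<open>
  Both algebras below live on \<open>complex^3\<close> with the standard basis, \<open>axis 1 1\<close> being even and
  \<open>axis 2 1\<close>, \<open>axis 3 1\<close> odd: this is \<open>h | v1, v2\<close> for the Heisenberg superalgebra and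
  \<open>e1 | e2, e3\<close> for the family \<open>L46\<close>.
\<close>

definition gr12 :: "bit \<Rightarrow> (complex^3) set" where
  "gr12 p = (if p = 0 then {x. x $ 2 = 0 \<and> x $ 3 = 0} else {x. x $ 1 = 0})"

definition heisenberg1 :: "(complex^3 \<Rightarrow> complex^3) \<Rightarrow> (complex^3) hom_superalgebra" where
  "heisenberg1 \<alpha> =
     \<lparr>scal = (*s), gr = gr12, brk = (\<lambda>x y. vector [x $ 2 * y $ 3 + x $ 3 * y $ 2, 0, 0]),
      twist = \<alpha>\<rparr>"

definition L46 :: "complex \<Rightarrow> complex \<Rightarrow> complex \<Rightarrow> complex \<Rightarrow> (complex^3) hom_superalgebra" where
  "L46 a b \<beta> \<mu> =
     \<lparr>scal = (*s), gr = gr12,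
      brk = (\<lambda>x y. vector [\<mu> * (x $ 2 * y $ 3 + x $ 3 * y $ 2),
                           \<beta> * (x $ 1 * y $ 3 - x $ 3 * y $ 1), 0]),
      twist = (*v) (vector [vector [0, 0, 0], vector [0, 0, a], vector [0, 0, b]])\<rparr>"

lemma gr12_span:
  "gr12 0 = vec.span {axis 1 1}" "gr12 1 = vec.span {axis 2 1, axis 3 1}"
  unfolding gr12_def vec.span_insert vec.span_singleton
  by (auto simp: vec_eq_iff forall_3 axis_def vec.span_singleton vec.span_breakdown_eq)

lemma heisenberg1_brk_basis:
  fixes \<alpha> defines "h \<equiv> axis 1 1" and "v1 \<equiv> axis 2 1" and "v2 \<equiv> axis 3 1"
  shows "brk (heisenberg1 \<alpha>) h h = 0" "brk (heisenberg1 \<alpha>) h v1 = 0" "brk (heisenberg1 \<alpha>) h v2 = 0"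
    "brk (heisenberg1 \<alpha>) v1 h = 0" "brk (heisenberg1 \<alpha>) v1 v1 = 0" "brk (heisenberg1 \<alpha>) v1 v2 = h"
    "brk (heisenberg1 \<alpha>) v2 h = 0" "brk (heisenberg1 \<alpha>) v2 v1 = h" "brk (heisenberg1 \<alpha>) v2 v2 = 0"
  unfolding h_def v1_def v2_def
  by (simp_all add: heisenberg1_def axis_def vec_eq_iff forall_3)

lemma L46_basis:
  fixes a b \<beta> \<mu> defines "e1 \<equiv> axis 1 1" and "e2 \<equiv> axis 2 1" and "e3 \<equiv> axis 3 1"
    and "L \<equiv> L46 a b \<beta> \<mu>"
  shows "brk L e1 e1 = 0" "brk L e1 e2 = 0" "brk L e1 e3 = \<beta> *s e2"
    "brk L e2 e1 = 0" "brk L e2 e2 = 0" "brk L e2 e3 = \<mu> *s e1"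
    "brk L e3 e1 = - (\<beta> *s e2)" "brk L e3 e2 = \<mu> *s e1" "brk L e3 e3 = 0"
    "twist L e1 = 0" "twist L e2 = 0" "twist L e3 = a *s e2 + b *s e3"
  unfolding e1_def e2_def e3_def L_def
  by (simp_all add: L46_def axis_def vec_eq_iff forall_3 matrix_vector_mult_def sum_3)

end

theory Submission
  imports Defs
begin

text \<open>
  Write \<open>h\<close> for the even basis vector, \<open>A\<close> for the restriction of \<open>\<alpha>\<close> to the odd plane, \<open>\<alpha> h = l h\<close>,
  \<open>B\<close> for the symmetric form with \<open>[v, w] = B(v, w) h\<close>, and \<open>D v = \<phi>(h, v)\<close>. The form \<open>B\<close> is a
  hyperbolic plane. Parity and skew symmetry leave in the deformed bracket only \<open>[h, v]\<^sub>t = t D v\<close>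
  and \<open>[v, w]\<^sub>t = T(v, w) h\<close> for a symmetric form \<open>T\<close>. If \<open>D = 0\<close>, then \<open>h\<close> is central, so all double
  brackets vanish and the deformation is a Lie superalgebra; hence \<open>D \<noteq> 0\<close>.

  Multiplicativity says \<open>B(A v, A w) = l B(v, w)\<close>, and \<open>\<phi>\<close> commuting with \<open>\<alpha>\<close> gives \<open>A D = l D A\<close>. The
  part of the deformed Hom-Jacobi identity that is linear in \<open>t\<close>
  (\<open>infinitesimal_deformation_cocycle\<close>) yields two further relations: \<open>D A = 0\<close> and
  \<open>B(A v, D w) + B(A w, D v) = 0\<close>. Now \<open>A D = 0\<close> and \<open>D \<noteq> 0\<close> make \<open>A\<close> singular, so \<open>l = 0\<close>. Choose an
  odd \<open>w\<close> with \<open>u = A w \<noteq> 0\<close>. The image of \<open>A\<close> is totally isotropic for \<open>B\<close>, so it is the line through \<open>u\<close>,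
  which is its own orthogonal complement; the second relation puts the image of \<open>D\<close> on the same
  line, and \<open>A D = 0\<close> then gives \<open>A u = 0\<close>. Thus in the basis \<open>u, w\<close> both \<open>A\<close> and \<open>D\<close> are multiples of
  one nilpotent Jordan block (\<open>heisenberg_deformation_shape\<close>).

  Applying \<open>\<alpha>\<close> to \<open>[w, w]\<^sub>t\<close> gives \<open>T(u, u) = 0\<close>. An isotropic vector of \<open>B\<close> lies on one of the two
  coordinate axes of the odd plane, so \<open>T(u, w) = 0\<close> would force \<open>[v\<^sub>1, v\<^sub>2]\<^sub>t = 0\<close>. As \<open>T(u, w) \<noteq> 0\<close>, adding a
  multiple of \<open>u\<close> to \<open>w\<close> achieves \<open>T(w, w) = 0\<close>. In the basis \<open>h, u, w\<close> the structure constants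
  are those of the family with \<open>a = 1\<close>, \<open>b = 0\<close> (\<open>hom_lie_isomorphic_L46I\<close>).
\<close>

section \<open>Infinitesimal deformations of Hom-Lie superalgebras\<close>

lemma linearD:
  assumes "Vector_Spaces.linear s1 s2 f"
  shows linearD_add: "f (x + y) = f x + f y"
    and linearD_scale: "f (s1 c x) = s2 c (f x)"
    and linearD_zero: "f 0 = 0"
    and linearD_minus: "f (- x) = - f x"
    and linearD_diff: "f (x - y) = f x - f y"
proof -
  interpret Vector_Spaces.linear s1 s2 f by fact
  show "f (x + y) = f x + f y" "f (s1 c x) = s2 c (f x)" "f 0 = 0" "f (- x) = - f x"
    "f (x - y) = f x - f y"
    by (simp_all add: add scale zero neg diff)
qed

lemma linear_add_scaled:
  assumes f: "Vector_Spaces.linear s1 s2 f" and g: "Vector_Spaces.linear s1 s2 g"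
  shows "Vector_Spaces.linear s1 s2 (\<lambda>x. f x + s2 t (g x))"
proof -
  interpret f: Vector_Spaces.linear s1 s2 f by fact
  show ?thesis
    unfolding Vector_Spaces.linear_iff
    using f.vs1.vector_space_axioms f.vs2.vector_space_axioms
    by (simp add: linearD[OF f] linearD[OF g] f.vs2.scale_right_distrib f.vs2.scale_left_commute ac_simps)
qed

lemma deform_sel [simp]:
  "scal (deform G \<phi> t) = scal G" "gr (deform G \<phi> t) = gr G" "twist (deform G \<phi> t) = twist G"
  "brk (deform G \<phi> t) x y = brk G x y + scal G t (\<phi> x y)"
  by (simp_all add: deform_def)

lemma super_skewD:
  assumes "super_skew G" "x \<in> gr G p" "y \<in> gr G q"
  shows "brk G x y = - scal G (ksign p q) (brk G y x)"
  using assms unfolding super_skew_def by blast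

lemma hom_lie_superalgebra_deform:
  assumes "infinitesimal_deformation G \<phi>"
  shows "hom_lie_superalgebra (deform G \<phi> t)"
proof -
  have sp: "super_space G" and b: "even_bilinear G (brk G)" and tw: "even_linear G G (twist G)"
    and p: "even_bilinear G \<phi>"
    and sk: "super_skew (deform G \<phi> t)" and jac: "hom_jacobi (deform G \<phi> t)"
    using assms by (auto simp: infinitesimal_deformation_def hom_lie_superalgebra_def)
  interpret vector_space "scal G" using sp by (simp add: super_space_def)
  have sub: "subspace (gr G p)" for p using sp by (simp add: super_space_def)
  have "even_bilinear (deform G \<phi> t) (brk (deform G \<phi> t))"
    using b p unfolding even_bilinear_def deform_sel
    by (intro conjI allI ballI linear_add_scaled subspace_add[OF sub] subspace_scale[OF sub]) blast+
  moreover have "super_space (deform G \<phi> t)" "even_linear (deform G \<phi> t) (deform G \<phi> t) (twist G)"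
    using sp tw by (simp_all add: super_space_def even_linear_def)
  ultimately show ?thesis using sk jac by (simp add: hom_lie_superalgebra_def)
qed

lemma multiplicative_deform:
  assumes "multiplicative G" "infinitesimal_deformation G \<phi>"
  shows "multiplicative (deform G \<phi> t)"
proof -
  have tw: "Vector_Spaces.linear (scal G) (scal G) (twist G)"
    and "\<And>x y. twist G (\<phi> x y) = \<phi> (twist G x) (twist G y)"
    using assms(2) by (auto simp: infinitesimal_deformation_def hom_lie_superalgebra_def even_linear_def)
  with assms(1) show ?thesis by (simp add: multiplicative_def linearD[OF tw])
qed

lemma infinitesimal_deformation_skew:
  assumes "infinitesimal_deformation G \<phi>" "x \<in> gr G p" "y \<in> gr G q"
  shows "\<phi> x y = - scal G (ksign p q) (\<phi> y x)"
proof -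
  interpret vector_space "scal G"
    using assms(1) by (simp add: infinitesimal_deformation_def hom_lie_superalgebra_def super_space_def)
  have "super_skew (deform G \<phi> t)" for t
    using assms(1) by (auto simp: infinitesimal_deformation_def)
  hence *: "brk G x y + scal G t (\<phi> x y) = - scal G (ksign p q) (brk G y x + scal G t (\<phi> y x))" for t
    using super_skewD[of "deform G \<phi> t" x p y q] assms(2,3) by simp
  have "brk G x y = - scal G (ksign p q) (brk G y x)" using *[of 0] by simp
  thus ?thesis using *[of 1] by (simp add: scale_right_distrib)
qed

text \<open>
  The deformed Hom-Jacobi expression is \<open>J\<^sub>0 + t J\<^sub>1 + t\<^sup>2 J\<^sub>2\<close>; as it vanishes for every \<open>t\<close>, so does
  \<open>J\<^sub>1\<close>: this is the 2-cocycle condition on \<open>\<phi>\<close>. The values \<open>t = 1\<close> and \<open>t = -1\<close> suffice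
  to isolate it.
\<close>

lemma infinitesimal_deformation_cocycle:
  assumes "infinitesimal_deformation G \<phi>" and x: "x \<in> gr G p" and y: "y \<in> gr G q" and z: "z \<in> gr G r"
  shows "scal G (ksign p r) (\<phi> (twist G x) (brk G y z) + brk G (twist G x) (\<phi> y z)) +
         scal G (ksign q p) (\<phi> (twist G y) (brk G z x) + brk G (twist G y) (\<phi> z x)) +
         scal G (ksign r q) (\<phi> (twist G z) (brk G x y) + brk G (twist G z) (\<phi> x y)) = 0"
    (is "?X = 0")
proof -
  interpret vector_space "scal G"
    using assms(1) by (simp add: infinitesimal_deformation_def hom_lie_superalgebra_def super_space_def)
  have b: "Vector_Spaces.linear (scal G) (scal G) (brk G x)"
    and p: "Vector_Spaces.linear (scal G) (scal G) (\<phi> x)" for x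
    using assms(1) by (auto simp: infinitesimal_deformation_def hom_lie_superalgebra_def even_bilinear_def)
  define J where "J t =
     scal G (ksign p r) (brk (deform G \<phi> t) (twist G x) (brk (deform G \<phi> t) y z)) +
     scal G (ksign q p) (brk (deform G \<phi> t) (twist G y) (brk (deform G \<phi> t) z x)) +
     scal G (ksign r q) (brk (deform G \<phi> t) (twist G z) (brk (deform G \<phi> t) x y))" for t
  have J: "J t = 0" for t
    using assms unfolding J_def infinitesimal_deformation_def hom_jacobi_def
    by (metis deform_sel(1,2,3))
  have "J 1 - J (-1) = ?X + ?X"
    by (simp add: J_def linearD[OF b] linearD[OF p] scale_right_distrib scale_right_diff_distrib algebra_simps)
  hence "scal G 2 ?X = 0"
    using J scale_left_distrib[of 1 1 ?X] by simp
  thus ?thesis by (simp only: scale_eq_0_iff) simp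
qed

section \<open>Hom-Lie superalgebras on the graded space of dimension (1, 2)\<close>

lemma vec3_eq_iff: "x = y \<longleftrightarrow> x$1 = y$1 \<and> x$2 = y$2 \<and> x$3 = y$3" for x y :: "'a^3"
  by (simp add: vec_eq_iff forall_3)

lemma L46_sel [simp]:
  "scal (L46 a b \<beta> \<mu>) = (*s)" "gr (L46 a b \<beta> \<mu>) = gr12"
  "brk (L46 a b \<beta> \<mu>) x y = vector [\<mu> * (x$2 * y$3 + x$3 * y$2), \<beta> * (x$1 * y$3 - x$3 * y$1), 0]"
  "twist (L46 a b \<beta> \<mu>) x = vector [0, a * x$3, b * x$3]"
  by (simp_all add: L46_def vec3_eq_iff matrix_vector_mult_def sum_3)

lemma mem_gr12 [simp]:
  "x \<in> gr12 0 \<longleftrightarrow> x$2 = 0 \<and> x$3 = 0" "x \<in> gr12 1 \<longleftrightarrow> x$1 = 0"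
  by (simp_all add: gr12_def)

lemma super_space_gr12:
  assumes "scal G = (*s)" "gr G = gr12"
  shows "super_space G"
proof -
  have "vec.subspace (gr12 p)" for p
    by (auto simp: vec.subspace_def gr12_def)
  moreover have "\<exists>a\<in>gr12 0. \<exists>b\<in>gr12 1. x = a + b" for x
    by (rule bexI[of _ "vector [x$1, 0, 0]"], rule bexI[of _ "vector [0, x$2, x$3]"])
      (simp_all add: vec3_eq_iff)
  ultimately show ?thesis
    unfolding super_space_def assms using vec.vector_space_axioms
    by (auto simp: vec3_eq_iff)
qed

text \<open>
  For \<open>b = 0\<close> the twisting map has image in the line of \<open>e\<^sub>2\<close>, and bracketing \<open>e\<^sub>2\<close> with any bracket gives
  zero, so each of the three terms of the Hom-Jacobi identity vanishes by itself.
\<close>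

lemma hom_lie_superalgebra_L46: "hom_lie_superalgebra (L46 a 0 \<beta> \<mu>)"
proof -
  have "even_bilinear (L46 a 0 \<beta> \<mu>) (brk (L46 a 0 \<beta> \<mu>))"
    by (auto simp: even_bilinear_def Vector_Spaces.linear_iff vec.vector_space_axioms vec3_eq_iff
        algebra_simps gr12_def split: if_splits)
  moreover have "even_linear (L46 a 0 \<beta> \<mu>) (L46 a 0 \<beta> \<mu>) (twist (L46 a 0 \<beta> \<mu>))"
    by (auto simp: even_linear_def Vector_Spaces.linear_iff vec.vector_space_axioms vec3_eq_iff
        algebra_simps gr12_def)
  moreover have "super_skew (L46 a 0 \<beta> \<mu>)"
    by (auto simp: super_skew_def ksign_def vec3_eq_iff gr12_def algebra_simps split: if_splits)
  moreover have "hom_jacobi (L46 a 0 \<beta> \<mu>)"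
    by (simp add: hom_jacobi_def vec3_eq_iff)
  ultimately show ?thesis
    by (simp add: hom_lie_superalgebra_def super_space_gr12)
qed

lemma even_bracket_self:
  fixes x :: "complex^3"
  assumes "super_skew G" "scal G = (*s)" "x \<in> gr G 0"
  shows "brk G x x = 0"
  using super_skewD[OF assms(1,3,3)] assms(2)
  by (simp add: ksign_def vec_eq_iff eq_neg_iff_add_eq_0)

text \<open>
  The skew symmetry supplies the remaining brackets of \<open>h, u, w\<close>, so the linear map sending the
  standard basis to \<open>h, u, w\<close> respects brackets and twisting maps. The required isomorphism is its
  inverse \<open>f\<close>, the coordinate map given by Cramer's rule.
\<close>

lemma hom_lie_isomorphic_L46I:
  fixes G :: "(complex^3) hom_superalgebra" and u w :: "complex^3"
  defines "h \<equiv> axis 1 1"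
  assumes G: "hom_lie_superalgebra G" and [simp]: "scal G = (*s)" "gr G = gr12"
    and u: "u \<in> gr12 1" and w: "w \<in> gr12 1" and indep: "u$2 * w$3 - u$3 * w$2 \<noteq> 0"
    and brk: "brk G h u = 0" "brk G h w = \<beta> *s u" "brk G u u = 0" "brk G u w = \<mu> *s h" "brk G w w = 0"
    and twist: "twist G h = 0" "twist G u = 0" "twist G w = a *s u"
  shows "hom_lie_isomorphic G (L46 a 0 \<beta> \<mu>)"
proof -
  let ?L = "L46 a 0 \<beta> \<mu>"
  have b1: "Vector_Spaces.linear (*s) (*s) (brk G x)"
    and b2: "Vector_Spaces.linear (*s) (*s) (\<lambda>x. brk G x y)"
    and tw: "Vector_Spaces.linear (*s) (*s) (twist G)" for x y
    using G by (auto simp: hom_lie_superalgebra_def even_bilinear_def even_linear_def)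
  have skew: "brk G x y = - (ksign p q *s brk G y x)" if "x \<in> gr12 p" "y \<in> gr12 q" for x y p q
    using super_skewD[of G x p y q] G that by (simp add: hom_lie_superalgebra_def)
  have h: "h \<in> gr12 0" by (simp add: h_def axis_def)
  have hh: "brk G h h = 0"
    using even_bracket_self[of G h] G h by (simp add: hom_lie_superalgebra_def)
  have brk': "brk G u h = 0" "brk G w h = - (\<beta> *s u)" "brk G w u = \<mu> *s h"
    using skew[OF u h] skew[OF w h] skew[OF w u] brk by (simp_all add: ksign_def)
  define g where "g y = y$1 *s h + y$2 *s u + y$3 *s w" for y :: "complex^3"
  let ?d = "u$2 * w$3 - u$3 * w$2"
  define f where "f x = (vector [x$1, (x$2 * w$3 - x$3 * w$2) / ?d, (u$2 * x$3 - u$3 * x$2) / ?d] :: complex^3)"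
    for x :: "complex^3"
  have gc: "g y $ 1 = y$1" "g y $ 2 = y$2 * u$2 + y$3 * w$2" "g y $ 3 = y$2 * u$3 + y$3 * w$3" for y
    using u w by (simp_all add: g_def h_def axis_def)
  have fg: "f (g y) = y" for y
  proof -
    have "(y$2 * u$2 + y$3 * w$2) * w$3 - (y$2 * u$3 + y$3 * w$3) * w$2 = y$2 * ?d"
      "u$2 * (y$2 * u$3 + y$3 * w$3) - u$3 * (y$2 * u$2 + y$3 * w$2) = y$3 * ?d" by algebra+
    thus ?thesis using indep by (simp add: f_def gc vec3_eq_iff)
  qed
  have gf: "g (f x) = x" for x
  proof -
    have "(x$2 * w$3 - x$3 * w$2) * u$2 + (u$2 * x$3 - u$3 * x$2) * w$2 = x$2 * ?d"
      "(x$2 * w$3 - x$3 * w$2) * u$3 + (u$2 * x$3 - u$3 * x$2) * w$3 = x$3 * ?d" by algebra+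
    hence "(x$2 * w$3 - x$3 * w$2) / ?d * u$2 + (u$2 * x$3 - u$3 * x$2) / ?d * w$2 = x$2"
      "(x$2 * w$3 - x$3 * w$2) / ?d * u$3 + (u$2 * x$3 - u$3 * x$2) / ?d * w$3 = x$3"
      using indep by (simp_all add: add_divide_distrib[symmetric])
    thus ?thesis by (simp add: f_def gc vec3_eq_iff)
  qed
  have g_brk: "brk G (g x) (g y) = g (brk ?L x y)" for x y
    unfolding g_def linearD[OF b1] linearD[OF b2] brk brk' hh
    by (simp add: vec_eq_iff algebra_simps)
  have g_twist: "twist G (g x) = g (twist ?L x)" for x
    unfolding g_def linearD[OF tw] twist
    by (simp add: vec_eq_iff algebra_simps)
  have "Vector_Spaces.linear (*s) (*s) f"
    by (simp add: Vector_Spaces.linear_iff vec.vector_space_axioms vec3_eq_iff f_def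
        add_divide_distrib[symmetric] algebra_simps)
  moreover have "f ` gr12 p \<subseteq> gr12 p" for p
    by (auto simp: f_def gr12_def)
  ultimately have "even_linear G ?L f" by (simp add: even_linear_def)
  moreover have "bij f" by (rule o_bij[of g]) (simp_all add: fun_eq_iff fg gf)
  moreover have "f (brk G x y) = brk ?L (f x) (f y)" for x y
    using g_brk[of "f x" "f y"] by (simp only: gf fg)
  moreover have "f \<circ> twist G = twist ?L \<circ> f"
    using g_twist[of "f _"] by (simp add: fun_eq_iff gf fg del: L46_sel)
  ultimately show ?thesis
    unfolding hom_lie_isomorphic_def using G hom_lie_superalgebra_L46 by blast
qed


lemma even_eq_scaled_axis:
  fixes x :: "complex^3"
  assumes "x \<in> gr12 0"
  shows "x = x$1 *s axis 1 1"
  using assms by (simp add: vec3_eq_iff axis_def)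

lemma odd_linear_eq_0:
  fixes f :: "complex^3 \<Rightarrow> complex^3"
  assumes f: "Vector_Spaces.linear (*s) (*s) f" and v: "v \<in> gr12 1"
    and p: "p \<in> gr12 1" "q \<in> gr12 1" "p$2 * q$3 - p$3 * q$2 \<noteq> 0"
    and zero: "f p = 0" "f q = 0"
  shows "f v = 0"
proof -
  let ?d = "p$2 * q$3 - p$3 * q$2"
  \<comment> \<open>Cramer's rule for \<open>v\<close> in terms of \<open>p\<close> and \<open>q\<close>, cleared of denominators\<close>
  have "?d *s v = (v$2 * q$3 - v$3 * q$2) *s p + (p$2 * v$3 - p$3 * v$2) *s q"
    using v p by (simp add: vec3_eq_iff algebra_simps)
  from arg_cong[where f=f, OF this] have "?d *s f v = 0"
    by (simp only: linearD_add[OF f] linearD_scale[OF f] zero vec.scale_zero_right add_0)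
  thus ?thesis using p(3) by (simp only: vec.scale_eq_0_iff) simp
qed

text \<open>
  The hypothesis makes \<open>h\<close> central. Two odd vectors have their bracket on the line of \<open>h\<close>, and any
  other bracket of homogeneous vectors is zero; in both cases bracketing once more gives zero.
\<close>

lemma super_jacobi_central:
  fixes G :: "(complex^3) hom_superalgebra"
  defines "h \<equiv> axis 1 1"
  assumes G: "hom_lie_superalgebra G" and sel [simp]: "scal G = (*s)" "gr G = gr12"
    and c: "\<And>v. v \<in> gr12 1 \<Longrightarrow> brk G h v = 0"
  shows "super_jacobi G"
proof -
  have b1: "Vector_Spaces.linear (*s) (*s) (brk G x)"
    and b2: "Vector_Spaces.linear (*s) (*s) (\<lambda>x. brk G x y)"
    and gr: "v \<in> gr12 1 \<Longrightarrow> w \<in> gr12 1 \<Longrightarrow> brk G v w \<in> gr12 (1 + 1)"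
    and sk: "super_skew G" for x y v w
    using G unfolding hom_lie_superalgebra_def even_bilinear_def sel by blast+
  have h: "h \<in> gr12 0" by (simp add: h_def axis_def)
  have parity: "p = 0 \<or> p = 1" for p :: bit by (cases p) auto
  have even: "\<exists>c. x = c *s h" if "x \<in> gr12 0" for x
    using even_eq_scaled_axis[OF that] unfolding h_def by blast
  have hh: "brk G h h = 0" using even_bracket_self[OF sk, of h] h by simp
  have left: "brk G x y = 0" if "x \<in> gr12 0" "y \<in> gr12 q" for x y q
    using even[OF that(1)] even[of y] that(2) parity[of q] c[of y] hh
    by (auto simp: linearD_scale[OF b1] linearD_scale[OF b2])
  have right: "brk G y x = 0" if "x \<in> gr12 0" "y \<in> gr12 q" for x y q
    using super_skewD[OF sk, of y q x 0] left[OF that] that by simp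
  have "brk G x (brk G y z) = 0" if "x \<in> gr12 p" "y \<in> gr12 q" "z \<in> gr12 r" for x y z p q r
  proof (cases "q = 1 \<and> r = 1")
    case True
    hence "brk G y z \<in> gr12 0" using gr[of y z] that by simp
    thus ?thesis using right that by blast
  next
    case False
    hence "brk G y z = 0" using parity[of q] parity[of r] left right that by blast
    thus ?thesis by (simp add: linearD_zero[OF b1])
  qed
  thus ?thesis by (simp add: super_jacobi_def)
qed

section \<open>Deformations of the Heisenberg superalgebra\<close>

lemma heisenberg1_sel [simp]:
  "scal (heisenberg1 \<alpha>) = (*s)" "gr (heisenberg1 \<alpha>) = gr12" "twist (heisenberg1 \<alpha>) = \<alpha>"
  "brk (heisenberg1 \<alpha>) x y = (x$2 * y$3 + x$3 * y$2) *s axis 1 1"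
  by (simp_all add: heisenberg1_def vec3_eq_iff axis_def)

text \<open>
  The relations \<open>D A = A D = 0\<close> and \<open>B(A v, D w) + B(A w, D v) = 0\<close> leave no other possibility once
  \<open>D \<noteq> 0\<close>: the twisting map kills \<open>h\<close>, and in the basis \<open>\<alpha> w, w\<close> of the odd plane \<open>A\<close> and \<open>D\<close> are both
  strictly upper triangular. That \<open>\<alpha> w\<close> is isotropic for \<open>B\<close> is recorded because it places \<open>\<alpha> w\<close> on
  one of the two coordinate axes.
\<close>

lemma heisenberg_deformation_shape:
  fixes \<alpha> :: "complex^3 \<Rightarrow> complex^3"
  defines "h \<equiv> axis 1 1"
  assumes mult: "multiplicative (heisenberg1 \<alpha>)"
    and nz: "\<alpha> \<noteq> (\<lambda>x. 0)"
    and def: "infinitesimal_deformation (heisenberg1 \<alpha>) \<phi>"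
    and D: "v0 \<in> gr12 1" "\<phi> h v0 \<noteq> 0"
  obtains w \<delta> where "w \<in> gr12 1" "\<alpha> w \<in> gr12 1" "\<alpha> w \<noteq> 0" "\<alpha> (\<alpha> w) = 0" "\<alpha> h = 0"
    "(\<alpha> w)$2 * (\<alpha> w)$3 = 0" "\<phi> h (\<alpha> w) = 0" "\<phi> h w = \<delta> *s \<alpha> w"
proof -
  let ?G = "heisenberg1 \<alpha>"
  define B where "B x y = x$2 * y$3 + x$3 * y$2" for x y :: "complex^3"
  have \<alpha>: "Vector_Spaces.linear (*s) (*s) \<alpha>" and \<alpha>_gr: "\<And>x p. x \<in> gr12 p \<Longrightarrow> \<alpha> x \<in> gr12 p"
    and \<phi>1: "\<And>x. Vector_Spaces.linear (*s) (*s) (\<phi> x)"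
    and \<phi>2: "\<And>y. Vector_Spaces.linear (*s) (*s) (\<lambda>x. \<phi> x y)"
    and \<phi>_gr: "\<And>x y p q. x \<in> gr12 p \<Longrightarrow> y \<in> gr12 q \<Longrightarrow> \<phi> x y \<in> gr12 (p + q)"
    and comm: "\<And>x y. \<alpha> (\<phi> x y) = \<phi> (\<alpha> x) (\<alpha> y)"
    using def unfolding infinitesimal_deformation_def hom_lie_superalgebra_def even_bilinear_def
      even_linear_def heisenberg1_sel by blast+
  have h: "h \<in> gr12 0" "h$1 = 1" by (simp_all add: h_def axis_def)
  have \<phi>_hv: "\<phi> h v \<in> gr12 1" if "v \<in> gr12 1" for v
    using \<phi>_gr[OF h(1) that] by simp
  have \<phi>_vw: "\<phi> v w \<in> gr12 0" if "v \<in> gr12 1" "w \<in> gr12 1" for v w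
    using \<phi>_gr[OF that] by simp
  have \<phi>_vh: "\<phi> v h = - \<phi> h v" if "v \<in> gr12 1" for v
    using infinitesimal_deformation_skew[OF def, of v 1 h 0] that h by (simp add: ksign_def)
  have "\<phi> h h = - \<phi> h h"
    using infinitesimal_deformation_skew[OF def, of h 0 h 0] h by (simp add: ksign_def)
  hence \<phi>_hh: "\<phi> h h = 0" by (simp add: vec_eq_iff eq_neg_iff_add_eq_0)
  define l where "l = (\<alpha> h)$1"
  have \<alpha>h: "\<alpha> h = l *s h"
    using even_eq_scaled_axis[OF \<alpha>_gr[OF h(1)]] by (simp add: l_def h_def)
  have B\<alpha>: "B (\<alpha> v) (\<alpha> w) = l * B v w" for v w
  proof -
    have "\<alpha> (B v w *s h) = B (\<alpha> v) (\<alpha> w) *s h"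
      using mult unfolding multiplicative_def heisenberg1_sel B_def h_def by blast
    hence "B v w *s \<alpha> h = B (\<alpha> v) (\<alpha> w) *s h" by (simp only: linearD_scale[OF \<alpha>])
    from arg_cong[where f="\<lambda>x. x$1", OF this] h show ?thesis by (simp add: \<alpha>h mult.commute)
  qed

  \<comment> \<open>The cocycle identity at \<open>(p, p, p)\<close> amounts to \<open>B(p, p) D A p = 0\<close>, and the odd plane has a basis of
     vectors that are not isotropic.\<close>
  have D\<alpha>: "\<phi> h (\<alpha> v) = 0" if "v \<in> gr12 1" for v
  proof -
    have *: "\<phi> h (\<alpha> p) = 0" if p: "p \<in> gr12 1" "B p p \<noteq> 0" for p
    proof -
      have "\<phi> (\<alpha> p) (B p p *s h) = 0"
        using infinitesimal_deformation_cocycle[OF def, of p 1 p 1 p 1] p \<alpha>_gr[OF p(1)] \<phi>_vw[OF p(1) p(1)]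
        by (simp add: ksign_def B_def h_def vec_eq_iff)
      thus ?thesis using p \<phi>_vh[OF \<alpha>_gr[OF p(1)]] by (simp add: linearD_scale[OF \<phi>1])
    qed
    let ?p = "vector [0, 1, 1] :: complex^3" and ?q = "vector [0, 1, - 1] :: complex^3"
    have lin: "Vector_Spaces.linear (*s) (*s) (\<lambda>v. \<phi> h (\<alpha> v))"
      by (simp add: Vector_Spaces.linear_iff vec.vector_space_axioms linearD[OF \<alpha>] linearD[OF \<phi>1])
    show ?thesis
      by (rule odd_linear_eq_0[OF lin that, of ?p ?q]) (simp_all add: * B_def)
  qed
  have \<alpha>D: "\<alpha> (\<phi> h v) = 0" if "v \<in> gr12 1" for v
    using D\<alpha>[OF that] by (simp add: comm \<alpha>h linearD_scale[OF \<phi>2])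
  \<comment> \<open>the cocycle identity at \<open>(h, v, w)\<close>\<close>
  have BD: "B (\<alpha> v) (\<phi> h w) + B (\<alpha> w) (\<phi> h v) = 0" if vw: "v \<in> gr12 1" "w \<in> gr12 1" for v w
  proof -
    from arg_cong[where f="\<lambda>x. x$1", OF infinitesimal_deformation_cocycle[OF def, of h 0 v 1 w 1]]
    show ?thesis
      using vw h \<phi>_vw[OF vw]
      by (simp add: ksign_def h_def[symmetric] \<alpha>h \<phi>_vh linearD_scale[OF \<phi>1]
          linearD_scale[OF \<phi>2] \<phi>_hh linearD_add[OF \<phi>1] linearD_zero[OF \<phi>1] B_def algebra_simps neg_eq_iff_add_eq_0)
  qed

  have l0: "l = 0"
  proof -
    \<comment> \<open>\<open>D v0\<close> is in the kernel of \<open>A\<close>, so \<open>l B(D v0, v) = B(A D v0, A v) = 0\<close>, while \<open>B\<close> is nondegenerate.\<close>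
    let ?y = "\<phi> h v0"
    have "l * B ?y v = 0" for v
      using B\<alpha>[of ?y v] \<alpha>D[OF D(1)] by (simp add: B_def)
    from this[of "axis 2 1"] this[of "axis 3 1"] show ?thesis
      using \<phi>_hv[OF D(1)] D(2) by (auto simp: B_def axis_def vec3_eq_iff)
  qed
  \<comment> \<open>As \<open>\<alpha> h = 0\<close>, a vector with nonzero image can be replaced by its odd part.\<close>
  obtain w where w: "w \<in> gr12 1" "\<alpha> w \<noteq> 0"
  proof -
    obtain x where x: "\<alpha> x \<noteq> 0" using nz by auto
    let ?w = "x - x$1 *s h"
    have "\<alpha> ?w = \<alpha> x" by (simp add: linearD[OF \<alpha>] \<alpha>h l0)
    moreover have "?w \<in> gr12 1" using h by simp
    ultimately show thesis using that x by metis
  qed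
  have u: "\<alpha> w \<in> gr12 1" using \<alpha>_gr w by blast
  \<comment> \<open>the isotropic line through \<open>\<alpha> w\<close> is its own orthogonal complement in the hyperbolic plane\<close>
  have orth: "\<exists>k. y = k *s \<alpha> w" if y: "y \<in> gr12 1" "B (\<alpha> w) y = 0" for y
  proof -
    have uu: "(\<alpha> w)$2 * (\<alpha> w)$3 = 0" using B\<alpha>[of w w] by (simp add: l0 B_def)
    show ?thesis
    proof (cases "(\<alpha> w)$2 = 0")
      case True
      with u w y show ?thesis
        by (intro exI[of _ "y$3 / (\<alpha> w)$3"]) (auto simp: B_def vec3_eq_iff)
    next
      case False
      with uu u w y show ?thesis
        by (intro exI[of _ "y$2 / (\<alpha> w)$2"]) (auto simp: B_def vec3_eq_iff)
    qed
  qed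
  have imD: "\<exists>k. \<phi> h v = k *s \<alpha> w" if v: "v \<in> gr12 1" for v
  proof (rule orth[OF \<phi>_hv[OF v]])
    obtain k where k: "\<alpha> v = k *s \<alpha> w"
      using orth[OF \<alpha>_gr[OF v]] B\<alpha>[of w v] l0 by auto
    have "B (\<alpha> w) (\<phi> h w) = 0" using BD[OF w(1) w(1)] by simp
    moreover have "B (\<alpha> v) (\<phi> h w) = k * B (\<alpha> w) (\<phi> h w)"
      by (simp add: k B_def algebra_simps)
    ultimately show "B (\<alpha> w) (\<phi> h v) = 0" using BD[OF w(1) v] by simp
  qed
  \<comment> \<open>Thus \<open>\<alpha> w\<close> is itself in the image of \<open>D\<close>, which \<open>A\<close> kills.\<close>
  obtain k where k: "\<phi> h v0 = k *s \<alpha> w" using imD D(1) by blast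
  have "k *s \<alpha> (\<alpha> w) = 0" using \<alpha>D[OF D(1)] by (simp add: k linearD_scale[OF \<alpha>])
  moreover have "k \<noteq> 0" using D(2) k by auto
  ultimately have "\<alpha> (\<alpha> w) = 0" by simp
  moreover have "(\<alpha> w)$2 * (\<alpha> w)$3 = 0" using B\<alpha>[of w w] by (simp add: l0 B_def)
  moreover have "\<alpha> h = 0" by (simp add: \<alpha>h l0)
  ultimately show thesis
    using that imD[OF w(1)] w u D\<alpha>[OF w(1)] by blast
qed

theorem proposition5p6:
  fixes \<alpha> :: "complex^3 \<Rightarrow> complex^3" and \<phi> :: "complex^3 \<Rightarrow> complex^3 \<Rightarrow> complex^3"
    and t :: complex
  assumes "hom_lie_superalgebra (heisenberg1 \<alpha>)"
    and "multiplicative (heisenberg1 \<alpha>)"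
    and "\<alpha> \<noteq> (\<lambda>x. 0)"
    and "infinitesimal_deformation (heisenberg1 \<alpha>) \<phi>"
    and "t \<noteq> 0"
    and "brk (deform (heisenberg1 \<alpha>) \<phi> t) (axis 2 1) (axis 3 1) \<noteq> 0"
    and "\<not> lie_superalgebra (deform (heisenberg1 \<alpha>) \<phi> t)"
  shows "\<exists>a \<beta> \<mu>. a \<noteq> 0 \<and> hom_lie_isomorphic (deform (heisenberg1 \<alpha>) \<phi> t) (L46 a 0 \<beta> \<mu>)"
proof -
  let ?H = "deform (heisenberg1 \<alpha>) \<phi> t" and ?h = "axis 1 1 :: complex^3"
  have H: "hom_lie_superalgebra ?H"
    using assms(4) by (rule hom_lie_superalgebra_deform)
  have sk: "super_skew ?H" using H by (simp add: hom_lie_superalgebra_def)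
  have sel: "scal ?H = (*s)" "gr ?H = gr12" by simp_all
  have "\<not> super_jacobi ?H"
    using assms(7) H by (simp add: lie_superalgebra_def hom_lie_superalgebra_def)
  then obtain v0 where "v0 \<in> gr12 1" "brk ?H ?h v0 \<noteq> 0"
    using super_jacobi_central[OF H sel] by blast
  hence v0: "v0 \<in> gr12 1" "\<phi> ?h v0 \<noteq> 0" by (auto simp: axis_def)
  obtain w \<delta> where w: "w \<in> gr12 1" and u: "\<alpha> w \<in> gr12 1" "\<alpha> w \<noteq> 0" "\<alpha> (\<alpha> w) = 0"
    and \<alpha>h: "\<alpha> ?h = 0" and iso: "(\<alpha> w)$2 * (\<alpha> w)$3 = 0"
    and \<phi>: "\<phi> ?h (\<alpha> w) = 0" "\<phi> ?h w = \<delta> *s \<alpha> w"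
    by (rule heisenberg_deformation_shape[OF assms(2,3,4) v0])
  define u where "u = \<alpha> w"
  define T where "T = brk ?H"
  have b1: "Vector_Spaces.linear (*s) (*s) (T x)"
    and b2: "Vector_Spaces.linear (*s) (*s) (\<lambda>x. T x y)"
    and odd: "x \<in> gr12 1 \<Longrightarrow> y \<in> gr12 1 \<Longrightarrow> T x y \<in> gr12 (1 + 1)"
    for x y
    using H unfolding hom_lie_superalgebra_def even_bilinear_def sel T_def by blast+
  have \<alpha>: "Vector_Spaces.linear (*s) (*s) \<alpha>"
    using assms(1) by (simp add: hom_lie_superalgebra_def even_linear_def)
  have T_odd: "T x y = (T x y)$1 *s ?h" if "x \<in> gr12 1" "y \<in> gr12 1" for x y
    using odd[OF that] by (intro even_eq_scaled_axis) simp
  have T_sym: "T x y = T y x" if "x \<in> gr12 1" "y \<in> gr12 1" for x y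
    using super_skewD[OF sk, of x 1 y 1] that unfolding sel T_def by (simp add: ksign_def)
  have T_h: "T ?h x = t *s \<phi> ?h x" for x
    by (simp add: T_def axis_def)
  have uu: "T u u = 0"
  proof -
    have "T u u = \<alpha> (T w w)"
      using multiplicative_deform[OF assms(2,4), of t] unfolding multiplicative_def u_def T_def
      by (metis deform_sel(3) heisenberg1_sel(3))
    also have "\<dots> = 0"
      by (subst T_odd[OF w w]) (simp add: linearD_scale[OF \<alpha>] \<alpha>h)
    finally show ?thesis .
  qed
  \<comment> \<open>\<open>w\<close> is not in the kernel of \<open>\<alpha>\<close>, whereas \<open>u\<close> is\<close>
  have indep: "u$2 * w$3 - u$3 * w$2 \<noteq> 0"
  proof
    assume "u$2 * w$3 - u$3 * w$2 = 0"
    hence "u$2 *s w = w$2 *s u" "u$3 *s w = w$3 *s u"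
      using w u(1) by (auto simp: vec3_eq_iff u_def algebra_simps)
    hence "u$2 *s u = 0" "u$3 *s u = 0"
      by (metis linearD_scale[OF \<alpha>] u(3) u_def vec.scale_zero_right)+
    thus False using u(1,2) by (auto simp: u_def vec3_eq_iff)
  qed
  define \<mu> where "\<mu> = (T u w)$1"
  have uw: "T u w = \<mu> *s ?h" unfolding \<mu>_def using T_odd u(1) w u_def by blast
  have \<mu>: "\<mu> \<noteq> 0"
  proof
    assume "\<mu> = 0"
    \<comment> \<open>Then \<open>u\<close> is in the radical of the deformed form, and so is the coordinate axis on which it lies.\<close>
    have rad: "T u v = 0" if "v \<in> gr12 1" for v
      by (rule odd_linear_eq_0[OF b1 that _ w indep]) (use uu uw u(1) \<open>\<mu> = 0\<close> u_def in simp_all)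
    have e: "axis 2 1 \<in> gr12 1" "axis 3 1 \<in> gr12 1" by (simp_all add: axis_def)
    have "T (axis 2 1) (axis 3 1) = 0"
    proof (cases "u$2 = 0")
      case True
      hence "u = u$3 *s axis 3 1" "u$3 \<noteq> 0" using u by (auto simp: u_def vec3_eq_iff axis_def)
      thus ?thesis using rad[OF e(1)] T_sym[OF e] linearD_scale[OF b2, of "u$3" "axis 3 1"]
        by (metis vec.scale_eq_0_iff)
    next
      case False
      hence "u = u$2 *s axis 2 1" using u iso by (auto simp: u_def vec3_eq_iff axis_def)
      thus ?thesis using False rad[OF e(2)] linearD_scale[OF b2, of "u$2" "axis 2 1"]
        by (metis vec.scale_eq_0_iff)
    qed
    thus False using assms(6) by (simp only: T_def)
  qed
  \<comment> \<open>\<open>T(w + c u, w + c u) = T(w, w) + 2 c \<mu>\<close>, and \<open>c\<close> is the zero of this\<close>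
  define c where "c = - (T w w)$1 / (2 * \<mu>)"
  define w' where "w' = w + c *s u"
  have w': "w' \<in> gr12 1" using w u(1) by (simp add: w'_def u_def)
  have "T w' w' = T w w + (2 * c) *s T u w"
    using T_sym[OF w u(1)]
    by (simp add: w'_def u_def[symmetric] linearD[OF b1] linearD[OF b2] uu vec_eq_iff algebra_simps)
  also have "\<dots> = ((T w w)$1 + 2 * c * \<mu>) *s ?h"
    unfolding uw by (subst T_odd[OF w w]) (simp add: vec_eq_iff algebra_simps)
  also have "\<dots> = 0" using \<mu> by (simp add: c_def)
  finally have ww: "T w' w' = 0" .
  have "hom_lie_isomorphic ?H (L46 1 0 (t * \<delta>) \<mu>)"
  proof (rule hom_lie_isomorphic_L46I[OF H sel _ w'])
    show "u \<in> gr12 1" using u by (simp add: u_def)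
    show "u$2 * w'$3 - u$3 * w'$2 \<noteq> 0" using indep by (simp add: w'_def algebra_simps)
    show "brk ?H ?h u = 0" "brk ?H ?h w' = (t * \<delta>) *s u"
      unfolding T_def[symmetric]
      by (simp_all add: w'_def linearD[OF b1] T_h \<phi> u_def)
    show "brk ?H u u = 0" "brk ?H w' w' = 0"
      using uu ww by (simp_all only: T_def)
    show "brk ?H u w' = \<mu> *s ?h"
      unfolding T_def[symmetric] by (simp add: uu uw w'_def linearD[OF b1])
    show "twist ?H ?h = 0" "twist ?H u = 0" "twist ?H w' = 1 *s u"
      by (simp_all add: \<alpha>h u u_def w'_def linearD[OF \<alpha>])
  qed
  thus ?thesis using zero_neq_one[where 'a=complex] by (metis (no_types))
qed

end
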